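(* Let $a$ be an integer. The (homogeneous) Jacobi--Perron expansion of the vector $(1,|\tau|,\tau^2)$ is periodic whenever (1) $\tau$ is a root of the polynomial $x^3+(a-1)x^2-ax-1$ where $a\geq 3$, or (2) $\tau$ is a root of the polynomial $x^3-(a-1)x^2-ax-1$ where $a\geq 5$.
   Context: All roots of these polynomials are real. The (homogeneous) Jacobi--Perron expansion (JPA expansion) of a vector $\boldsymbol{\beta}^{(0)}=(\beta_1^{(0)},\beta_2^{(0)},\beta_3^{(0)})\in\mathbb{R}^3$ is the sequence of vectors $\boldsymbol{\beta}^{(k)}$, $k\ge 0$, defined by $$\boldsymbol{\beta}^{(k+1)}=\left(\beta_2^{(k)}-b_2^{(k)}\beta_1^{(k)},\ \beta_3^{(k)}-b_3^{(k)}\beta_1^{(k)},\ \beta_1^{(k)}\right),\qquad b_i^{(k)}=\left\lfloor \beta_i^{(k)}/\beta_1^{(k)}\right\rfloor .$$ The expansion is called periodic if there exist integers $l_0\ge 0$, $l_1\ge 1$ and a unit $\varepsilon$ (of the ring of integers of $\mathbb{Q}(\tau)$) such that $\beta_i^{(k+l_1)}=\varepsilon\beta_i^{(k)}$ for all $1\le i\le 3$ and all $k\ge l_0$. *)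

theory Defs
  imports "HOL-Analysis.Analysis" "HOL-Computational_Algebra.Polynomial"
begin

text \<open>At a zero first coordinate (not reached from a vector with rationally independent
  coordinates) the convention \<open>x / 0 = 0\<close> makes the digits \<open>0\<close>.\<close>

definition jpa_digit :: "real ^ 3 \<Rightarrow> 3 \<Rightarrow> int" where
  "jpa_digit \<beta> i = \<lfloor>\<beta> $ i / \<beta> $ 1\<rfloor>"

definition jpa_step :: "real ^ 3 \<Rightarrow> real ^ 3" where
  "jpa_step \<beta> = vector [\<beta> $ 2 - of_int (jpa_digit \<beta> 2) * \<beta> $ 1,
                        \<beta> $ 3 - of_int (jpa_digit \<beta> 3) * \<beta> $ 1,
                        \<beta> $ 1]"

definition jpa_expansion :: "real ^ 3 \<Rightarrow> nat \<Rightarrow> real ^ 3" where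
  "jpa_expansion \<beta> k = (jpa_step ^^ k) \<beta>"

definition is_subfield :: "'a::field set \<Rightarrow> bool" where
  "is_subfield K \<longleftrightarrow> 1 \<in> K \<and> (\<forall>x\<in>K. \<forall>y\<in>K. x - y \<in> K \<and> x * y \<in> K) \<and> (\<forall>x\<in>K. inverse x \<in> K)"

text \<open>The field \<open>\<rat>(\<tau>)\<close>; every subfield of a field of characteristic \<open>0\<close> contains the rationals.\<close>

definition rat_adjoin :: "'a::field_char_0 \<Rightarrow> 'a set" where
  "rat_adjoin \<tau> = is_subfield hull {\<tau>}"

definition ring_of_integers :: "'a::field_char_0 set \<Rightarrow> 'a set" where
  "ring_of_integers K = {x \<in> K. algebraic_int x}"

definition units_of_set :: "'a::comm_ring_1 set \<Rightarrow> 'a set" where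
  "units_of_set R = {x \<in> R. \<exists>y\<in>R. x * y = 1}"

text \<open>The number \<open>\<tau>\<close> only determines the field in which the unit is sought.\<close>

definition jpa_periodic :: "real \<Rightarrow> real ^ 3 \<Rightarrow> bool" where
  "jpa_periodic \<tau> \<beta> \<longleftrightarrow>
     (\<exists>l0 l1. l1 \<ge> 1 \<and>
       (\<exists>\<epsilon> \<in> units_of_set (ring_of_integers (rat_adjoin \<tau>)).
         \<forall>k\<ge>l0. \<forall>i. jpa_expansion \<beta> (k + l1) $ i = \<epsilon> * jpa_expansion \<beta> k $ i))"

end

theory Submission
  imports Defs
begin

text \<open>
  The defining equation is linear in \<open>a\<close>. Solving it for \<open>a\<close> in terms of \<open>u = \<bar>\<tau>\<bar>\<close> turns
  every vector of the expansion into a triple of rational functions of \<open>u\<close> alone, with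
  denominators \<open>u^i (u \<plusminus> 1)^j\<close>, and the lower bound on \<open>a\<close> confines \<open>u\<close> to a short interval for
  each of the three real roots. In each of the six resulting cases the digits are fixed polynomials
  in \<open>a\<close>, and after a bounded number of steps a vector recurs up to a factor \<open>\<plusminus>u^i (u \<plusminus> 1)^j\<close>,
  which is a unit because \<open>\<tau>\<close> and \<open>\<tau> - 1\<close> (respectively \<open>\<tau> + 1\<close>) are units. Concretely, the
  factor is a root of a monic integer cubic with constant term \<open>-1\<close>.
\<close>

section \<open>Scaling invariance and certified steps of the Jacobi-Perron expansion\<close>

lemma vector_3_scaleR: "c *\<^sub>R (vector [x, y, z] :: real ^ 3) = vector [c * x, c * y, c * z]"
  by (simp add: vec_eq_iff forall_3)

lemma jpa_digit_scaleR: "c \<noteq> 0 \<Longrightarrow> jpa_digit (c *\<^sub>R \<beta>) i = jpa_digit \<beta> i"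
  by (simp add: jpa_digit_def)

lemma jpa_step_scaleR: "c \<noteq> 0 \<Longrightarrow> jpa_step (c *\<^sub>R \<beta>) = c *\<^sub>R jpa_step \<beta>"
  by (simp add: jpa_step_def jpa_digit_scaleR vector_3_scaleR algebra_simps)

lemma jpa_expansion_Suc: "jpa_expansion \<beta> (Suc k) = jpa_step (jpa_expansion \<beta> k)"
  by (simp add: jpa_expansion_def)

text \<open>The digits depend only on ratios of coordinates, so a step commutes with scaling by a
  nonzero number. A single recurrence up to \<open>\<epsilon>\<close> therefore propagates by
  induction to all later indices. Coordinates are listed separately so that each use leaves three
  scalar identities.\<close>

lemma jpa_periodicI:
  assumes k: "jpa_expansion \<beta> k = vector [p, q, r]"
    and m: "jpa_expansion \<beta> m = vector [p', q', r']" and "k < m"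
    and eps: "\<epsilon> \<in> units_of_set (ring_of_integers (rat_adjoin \<tau>))"
    and scale: "p' = \<epsilon> * p" "q' = \<epsilon> * q" "r' = \<epsilon> * r"
  shows "jpa_periodic \<tau> \<beta>"
proof -
  obtain l where l: "m = k + l" "l \<ge> 1"
    using \<open>k < m\<close> that[of "m - k"] by simp
  have "\<epsilon> \<noteq> 0"
    using eps by (auto simp: units_of_set_def)
  have "jpa_expansion \<beta> (n + l) = \<epsilon> *\<^sub>R jpa_expansion \<beta> n" if "n \<ge> k" for n
    using that
  proof (induction n rule: dec_induct)
    case base
    then show ?case
      using k m by (simp add: scale l vector_3_scaleR)
  next
    case (step n)
    then show ?case
      by (simp add: jpa_expansion_Suc jpa_step_scaleR \<open>\<epsilon> \<noteq> 0\<close>)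
  qed
  then show ?thesis
    unfolding jpa_periodic_def using eps l(2)
    by (metis real_scaleR_def vector_scaleR_component)
qed

text \<open>A certificate for one step. The remainders \<open>q'\<close>, \<open>r'\<close> are
  positive and fall short of \<open>p\<close> by the positive gaps \<open>s\<close>,
  \<open>t\<close>; this pins both floors without any explicit computation of a floor. Having
  \<open>m = Suc k\<close> as a premise lets numerals serve as indices.\<close>

lemma jpa_expansion_step:
  assumes "jpa_expansion \<beta> k = vector [p, q, r]"
    and pos: "0 < q'" "0 < r'" "0 < s" "0 < t"
    and p: "p = q' + s" "p = r' + t"
    and qr: "q = q' + of_int d * p" "r = r' + of_int e * p"
    and "m = Suc k"
  shows "jpa_expansion \<beta> m = vector [q', r', p]"
proof -
  have "p > 0"
    using p pos by linarith
  then have "\<lfloor>q / p\<rfloor> = d" "\<lfloor>r / p\<rfloor> = e"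
    unfolding floor_eq_iff using qr p pos by (simp_all add: field_simps)
  then show ?thesis
    using assms by (simp add: jpa_expansion_Suc jpa_step_def jpa_digit_def)
qed

lemmas pos_intros = mult_pos_pos divide_pos_pos zero_less_power zero_less_one zero_less_numeral

section \<open>The field generated by the root, and units from monic integer cubics\<close>

text \<open>Intersections of subfields are subfields, so the hull is itself a subfield.\<close>

lemma is_subfield_rat_adjoin: "is_subfield (rat_adjoin \<tau>)"
  unfolding rat_adjoin_def by (rule hull_in) (auto simp: is_subfield_def)

lemma rat_adjoin_self: "\<tau> \<in> rat_adjoin \<tau>"
  unfolding rat_adjoin_def using hull_subset[of "{\<tau>}" is_subfield] by blast

context
  fixes K :: "'a :: field set"
  assumes K: "is_subfield K"
begin

lemma is_subfield_one: "1 \<in> K"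
  and is_subfield_diff: "x \<in> K \<Longrightarrow> y \<in> K \<Longrightarrow> x - y \<in> K"
  and is_subfield_mult: "x \<in> K \<Longrightarrow> y \<in> K \<Longrightarrow> x * y \<in> K"
  and is_subfield_inverse: "x \<in> K \<Longrightarrow> inverse x \<in> K"
  using K by (auto simp: is_subfield_def)

lemma is_subfield_uminus: "x \<in> K \<Longrightarrow> - x \<in> K"
  by (metis is_subfield_diff is_subfield_one diff_self diff_0)

lemma is_subfield_add: "x \<in> K \<Longrightarrow> y \<in> K \<Longrightarrow> x + y \<in> K"
  by (metis is_subfield_diff is_subfield_uminus diff_minus_eq_add)

lemma is_subfield_divide: "x \<in> K \<Longrightarrow> y \<in> K \<Longrightarrow> x / y \<in> K"
  by (simp add: divide_inverse is_subfield_mult is_subfield_inverse)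

lemma is_subfield_power: "x \<in> K \<Longrightarrow> x ^ n \<in> K"
  by (induction n) (simp_all add: is_subfield_one is_subfield_mult)

lemmas is_subfield_intros = is_subfield_one is_subfield_diff is_subfield_add
  is_subfield_mult is_subfield_divide is_subfield_power

end

lemma algebraic_int_cubic:
  fixes x :: "'a :: field_char_0"
  assumes "x^3 + of_int p * x^2 + of_int q * x + of_int r = 0"
  shows "algebraic_int x"
proof (rule algebraic_int.intros)
  show "poly [:of_int r, of_int q, of_int p, 1:] x = 0"
    using assms by (simp add: algebra_simps power2_eq_square power3_eq_cube)
  show "\<forall>i. coeff [:of_int r, of_int q, of_int p, 1:] i \<in> (\<int> :: 'a set)"
    by (auto simp: coeff_pCons split: nat.split)
qed simp

text \<open>Dividing the cubic by \<open>- \<epsilon>^3\<close> reverses its coefficients. Because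
  the constant term is -1, the reversed cubic is again monic with integer coefficients, so the
  inverse is an algebraic integer too.\<close>

lemma unit_of_cubic:
  fixes \<epsilon> :: "'a :: field_char_0"
  assumes K: "is_subfield K" "\<epsilon> \<in> K" and cubic: "\<epsilon>^3 + of_int p * \<epsilon>^2 + of_int q * \<epsilon> - 1 = 0"
  shows "\<epsilon> \<in> units_of_set (ring_of_integers K)"
proof -
  have "\<epsilon> \<noteq> 0"
    using cubic by auto
  have "inverse \<epsilon>^3 + of_int (- q) * inverse \<epsilon>^2 + of_int (- p) * inverse \<epsilon> + of_int (- 1)
      = - (inverse \<epsilon>^3) * (\<epsilon>^3 + of_int p * \<epsilon>^2 + of_int q * \<epsilon> - 1)"
    using \<open>\<epsilon> \<noteq> 0\<close> by (simp add: field_simps power2_eq_square power3_eq_cube)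
  also have "\<dots> = 0"
    by (simp add: cubic)
  finally have "inverse \<epsilon>^3 + of_int (- q) * inverse \<epsilon>^2 + of_int (- p) * inverse \<epsilon> + of_int (- 1) = 0" .
  then have "algebraic_int (inverse \<epsilon>)"
    by (rule algebraic_int_cubic)
  moreover have "algebraic_int \<epsilon>"
    using cubic by (intro algebraic_int_cubic[of _ p q "- 1"]) simp
  ultimately show ?thesis
    using K \<open>\<epsilon> \<noteq> 0\<close> is_subfield_inverse[OF K]
    by (auto simp: units_of_set_def ring_of_integers_def intro!: bexI[of _ "inverse \<epsilon>"])
qed

section \<open>The expansions for the three roots of the first family\<close>

text \<open>With these comparisons of consecutive powers, the polynomial inequalities collected in
  \<open>pos\<close> below become linear in the powers of u and fall to linear arithmetic.\<close>

lemma power_gt_mult: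
  fixes u c :: real
  assumes "0 < u" "c < u"
  shows "c * u < u^2" "c * u^2 < u^3" "c * u^3 < u^4"
  using assms by (simp_all add: power_numeral_reduce)

lemma power2_less_mult: "0 < u \<Longrightarrow> u < c \<Longrightarrow> u^2 < c * u" for u c :: real
  by (simp add: power2_eq_square)

text \<open>Applied with u = -\<tau>. The vectors at indices 1 and 4 are proportional, with factor
  1/(u(u+1)) = a - u = a + \<tau>. The cubic of the factor is thus the defining polynomial shifted
  by a.\<close>

lemma family1_large_negative_root:
  fixes a :: int and u \<tau> :: real
  assumes a: "of_int a = u + 1 / (u * (u + 1))" and u: "14/5 < u"
    and K: "u \<in> rat_adjoin \<tau>"
  shows "jpa_periodic \<tau> (vector [1, u, u^2])"
proof -
  let ?E = "jpa_expansion (vector [1, u, u^2])"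
  \<comment> \<open>These are the factors of all remainders and gaps below. The tightest is the
    quartic with the term -2u^3, positive only from about u = 2.70 on; the root for a = 3 is about
    2.91, and 14/5 lies between.\<close>
  have pos: "0 < u" "0 < u + 1" "0 < 2 * u^3 + 2 * u^2 + 1" "0 < 2 * u^3 + u^2 - u + 1" "0 < u^2 + u - 1"
    "0 < u^2 + u - 2" "0 < u^4 - 2 * u^2 - u - 1" "0 < u^4 - 2 * u^3 - 2 * u^2 + u - 2" "0 < u^4 - u^2 - 1"
    using u power_gt_mult[OF _ u] by auto
  have nz: "u \<noteq> 0" "u + 1 \<noteq> 0"
    using u by auto
  have E0: "?E 0 = vector [1, u, u^2]"
    by (simp add: jpa_expansion_def)
  \<comment> \<open>As u lies just below a, the digits are a - 1 and a^2 - 1. Substituting the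
    formula for \<open>a\<close> turns the side conditions that do not hold for symbolic
    \<open>a\<close> into rational identities in u.\<close>
  have E1: "?E 1 = vector [(u^2 + u - 1) / (u * (u + 1)), (u^4 - u^2 - 1) / (u^2 * (u + 1)^2), 1]"
    by (rule jpa_expansion_step[OF E0, where d = "a - 1" and e = "a^2 - 1"
          and s = "1 / (u * (u + 1))" and t = "(2 * u^3 + 2 * u^2 + 1) / (u^2 * (u + 1)^2)"],
        (intro pos_intros pos)+,
        ((simp add: algebra_simps power_numeral_reduce; fail) |
         (simp add: a divide_simps nz; simp add: algebra_simps power_numeral_reduce))+)
  have E2: "?E 2 = vector
      [(u^4 - u^2 - 1) / (u^2 * (u + 1)^2),
       1 / (u * (u + 1)),
       (u^2 + u - 1) / (u * (u + 1))]"
    by (rule jpa_expansion_step[OF E1, where d = "0" and e = "1"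
          and s = "(2 * u^3 + u^2 - u + 1) / (u^2 * (u + 1)^2)" and t = "(u^2 + u - 2) / (u * (u + 1))"],
        (intro pos_intros pos)+,
        ((simp add: algebra_simps power_numeral_reduce; fail) |
         (simp add: a divide_simps nz; simp add: algebra_simps power_numeral_reduce))+)
  have E3: "?E 3 = vector
      [1 / (u * (u + 1)),
       (2 * u^3 + u^2 - u + 1) / (u^2 * (u + 1)^2),
       (u^4 - u^2 - 1) / (u^2 * (u + 1)^2)]"
    by (rule jpa_expansion_step[OF E2, where d = "0" and e = "1"
          and s = "(u^4 - 2 * u^2 - u - 1) / (u^2 * (u + 1)^2)"
          and t = "(u^4 - 2 * u^3 - 2 * u^2 + u - 2) / (u^2 * (u + 1)^2)"],
        (intro pos_intros pos)+,
        ((simp add: algebra_simps power_numeral_reduce; fail) |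
         (simp add: a divide_simps nz; simp add: algebra_simps power_numeral_reduce))+)
  have E4: "?E 4 = vector
      [(u^2 + u - 1) / (u^2 * (u + 1)^2),
       (u^4 - u^2 - 1) / (u^3 * (u + 1)^3),
       1 / (u * (u + 1))]"
    by (rule jpa_expansion_step[OF E3, where d = "2 * a - 2" and e = "a^2 - a - 1"
          and s = "1 / (u^2 * (u + 1)^2)" and t = "(2 * u^3 + 2 * u^2 + 1) / (u^3 * (u + 1)^3)"],
        (intro pos_intros pos)+,
        ((simp add: algebra_simps power_numeral_reduce; fail) |
         (simp add: a divide_simps nz; simp add: algebra_simps power_numeral_reduce))+)
  show ?thesis
  proof (rule jpa_periodicI[OF E1 E4 _ unit_of_cubic[OF is_subfield_rat_adjoin]])
    show "1 / (u * (u + 1)) \<in> rat_adjoin \<tau>"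
      by (intro is_subfield_intros[OF is_subfield_rat_adjoin] K)
    show "(1 / (u * (u + 1)))^3 + of_int (- (2 * a + 1)) * (1 / (u * (u + 1)))^2
        + of_int (a^2 + a) * (1 / (u * (u + 1))) - 1 = 0"
      by (simp add: a divide_simps nz; simp add: algebra_simps power_numeral_reduce)
  qed (simp add: divide_simps nz; simp add: algebra_simps power_numeral_reduce)+
qed

text \<open>Applied with u = -\<tau>, where a is close to 1/u. The vectors at indices 3 and 10
  differ by the factor u^3/(u+1). Its cubic is the characteristic polynomial: the coefficients are
  symmetric functions of the conjugates, and the norm is 1 because u and u+1 both have norm
  -1.\<close>

lemma family1_small_negative_root:
  fixes a :: int and u \<tau> :: real
  assumes a: "of_int a = u + 1 / (u * (u + 1))" and u: "0 < u" "u < 3/10"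
    and K: "u \<in> rat_adjoin \<tau>"
  shows "jpa_periodic \<tau> (vector [1, u, u^2])"
proof -
  let ?E = "jpa_expansion (vector [1, u, u^2])"
  \<comment> \<open>The strongest demand is 1 - 2u - 2u^2 > 0, that is, u below about 0.366. For a =
    3 the root is about 0.286.\<close>
  have pos: "0 < u" "0 < u + 1" "0 < 1 - 2 * u - 2 * u^2" "0 < 1 - 2 * u - u^2" "0 < 1 - 2 * u"
    "0 < 1 - 2 * u^2" "0 < 1 - u - u^2" "0 < 1 - u" "0 < 2 * u + 3" "0 < u + 2"
    using u power2_less_mult[OF u] by auto
  have nz: "u \<noteq> 0" "u + 1 \<noteq> 0"
    using u by auto
  have E0: "?E 0 = vector [1, u, u^2]"
    by (simp add: jpa_expansion_def)
  have E1: "?E 1 = vector [u, u^2, 1]"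
    by (rule jpa_expansion_step[OF E0, where d = "0" and e = "0"
          and s = "(1 - u)" and t = "(u + 1) * (1 - u)"],
        (intro pos_intros pos)+,
        ((simp add: algebra_simps power_numeral_reduce; fail) |
         (simp add: a divide_simps nz; simp add: algebra_simps power_numeral_reduce))+)
  have E2: "?E 2 = vector [u^2, u * (1 - u - u^2) / (u + 1), u]"
    by (rule jpa_expansion_step[OF E1, where d = "0" and e = "a"
          and s = "u * (1 - u)" and t = "u^2 * (u + 2) / (u + 1)"],
        (intro pos_intros pos)+,
        ((simp add: algebra_simps power_numeral_reduce; fail) |
         (simp add: a divide_simps nz; simp add: algebra_simps power_numeral_reduce))+)
  have E3: "?E 3 = vector [u^2 * (1 - u), u^2 * (1 - u - u^2) / (u + 1), u^2]"
    by (rule jpa_expansion_step[OF E2, where d = "a - 2" and e = "a"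
          and s = "u^3" and t = "u^3 * (u + 2) / (u + 1)"],
        (intro pos_intros pos)+,
        ((simp add: algebra_simps power_numeral_reduce; fail) |
         (simp add: a divide_simps nz; simp add: algebra_simps power_numeral_reduce))+)
  have E4: "?E 4 = vector [u^2 * (1 - u - u^2) / (u + 1), u^3, u^2 * (1 - u)]"
    by (rule jpa_expansion_step[OF E3, where d = "0" and e = "1"
          and s = "u^3 / (u + 1)" and t = "u^2 * (1 - 2 * u)"],
        (intro pos_intros pos)+,
        ((simp add: algebra_simps power_numeral_reduce; fail) |
         (simp add: a divide_simps nz; simp add: algebra_simps power_numeral_reduce))+)
  have E5: "?E 5 = vector [u^3, u^3 / (u + 1), u^2 * (1 - u - u^2) / (u + 1)]"
    by (rule jpa_expansion_step[OF E4, where d = "0" and e = "1"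
          and s = "u^2 * (1 - 2 * u - 2 * u^2) / (u + 1)" and t = "u^2 * (1 - 2 * u - u^2) / (u + 1)"],
        (intro pos_intros pos)+,
        ((simp add: algebra_simps power_numeral_reduce; fail) |
         (simp add: a divide_simps nz; simp add: algebra_simps power_numeral_reduce))+)
  have E6: "?E 6 = vector [u^3 / (u + 1), u^3 * (1 - u), u^3]"
    by (rule jpa_expansion_step[OF E5, where d = "0" and e = "a - 2"
          and s = "u^4 / (u + 1)" and t = "u^4"],
        (intro pos_intros pos)+,
        ((simp add: algebra_simps power_numeral_reduce; fail) |
         (simp add: a divide_simps nz; simp add: algebra_simps power_numeral_reduce))+)
  have E7: "?E 7 = vector [u^3 * (1 - u), u^4 / (u + 1), u^3 / (u + 1)]"
    by (rule jpa_expansion_step[OF E6, where d = "0" and e = "1"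
          and s = "u^5 / (u + 1)" and t = "u^3 * (1 - u) / (u + 1)"],
        (intro pos_intros pos)+,
        ((simp add: algebra_simps power_numeral_reduce; fail) |
         (simp add: a divide_simps nz; simp add: algebra_simps power_numeral_reduce))+)
  have E8: "?E 8 = vector [u^4 / (u + 1), u^5 / (u + 1), u^3 * (1 - u)]"
    by (rule jpa_expansion_step[OF E7, where d = "0" and e = "1"
          and s = "u^3 * (1 - u - u^2) / (u + 1)" and t = "u^3 * (1 - 2 * u^2) / (u + 1)"],
        (intro pos_intros pos)+,
        ((simp add: algebra_simps power_numeral_reduce; fail) |
         (simp add: a divide_simps nz; simp add: algebra_simps power_numeral_reduce))+)
  have E9: "?E 9 = vector [u^5 / (u + 1), u^4 * (1 - 2 * u - 2 * u^2) / (u + 1)^2, u^4 / (u + 1)]"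
    by (rule jpa_expansion_step[OF E8, where d = "0" and e = "a"
          and s = "u^4 * (1 - u) / (u + 1)" and t = "u^5 * (2 * u + 3) / (u + 1)^2"],
        (intro pos_intros pos)+,
        ((simp add: algebra_simps power_numeral_reduce; fail) |
         (simp add: a divide_simps nz; simp add: algebra_simps power_numeral_reduce))+)
  \<comment> \<open>The digit a - 3 vanishes at a = 3. For a = 2 it would be negative, which is
    impossible for a vector with positive entries, so this digit pattern starts at a = 3.\<close>
  have E10: "?E 10 = vector [u^5 * (1 - u) / (u + 1), u^5 * (1 - u - u^2) / (u + 1)^2, u^5 / (u + 1)]"
    by (rule jpa_expansion_step[OF E9, where d = "a - 3" and e = "a"
          and s = "u^6 / (u + 1)" and t = "u^6 * (u + 2) / (u + 1)^2"],
        (intro pos_intros pos)+,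
        ((simp add: algebra_simps power_numeral_reduce; fail) |
         (simp add: a divide_simps nz; simp add: algebra_simps power_numeral_reduce))+)
  show ?thesis
  proof (rule jpa_periodicI[OF E3 E10 _ unit_of_cubic[OF is_subfield_rat_adjoin]])
    show "u^3 / (u + 1) \<in> rat_adjoin \<tau>"
      by (intro is_subfield_intros[OF is_subfield_rat_adjoin] K)
    show "(u^3 / (u + 1))^3 + of_int (- (a^2 + 6)) * (u^3 / (u + 1))^2
        + of_int (a^3 + 4 * a^2 - a - 5) * (u^3 / (u + 1)) - 1 = 0"
      by (simp add: a divide_simps nz; simp add: algebra_simps power_numeral_reduce)
  qed (simp add: divide_simps nz; simp add: algebra_simps power_numeral_reduce)+
qed

text \<open>Applied with u = \<tau>. The vectors at indices 2 and 4 differ by (u-1)^2/u = u - 2 +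
  1/u, whose trace -(2a+5) is read off from the traces of \<tau> and 1/\<tau>.\<close>

lemma family1_positive_root:
  fixes a :: int and u \<tau> :: real
  assumes a: "of_int a = 1 / (u * (u - 1)) - u" and u: "1 < u" "u < 6/5"
    and K: "u \<in> rat_adjoin \<tau>"
  shows "jpa_periodic \<tau> (vector [1, u, u^2])"
proof -
  let ?E = "jpa_expansion (vector [1, u, u^2])"
  have pos: "0 < u" "0 < u - 1" "0 < 2 - u" "0 < 2 - u^2" "0 < 3 * u - 1 - u^2"
    "0 < u + 1"
    using u power2_less_mult[OF _ u(2)] by auto
  have nz: "u \<noteq> 0" "u \<noteq> 1" "1 \<noteq> u"
    using u by auto
  have E0: "?E 0 = vector [1, u, u^2]"
    by (simp add: jpa_expansion_def)
  have E1: "?E 1 = vector [(u - 1), (u - 1) * (u + 1), 1]"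
    by (rule jpa_expansion_step[OF E0, where d = "1" and e = "1"
          and s = "(2 - u)" and t = "(2 - u^2)"],
        (intro pos_intros pos)+,
        ((simp add: algebra_simps power_numeral_reduce; fail) |
         (simp add: a divide_simps nz; simp add: algebra_simps power_numeral_reduce))+)
  have E2: "?E 2 = vector [(u - 1)^2, (u - 1)^3 / u, (u - 1)]"
    by (rule jpa_expansion_step[OF E1, where d = "2" and e = "a + 2"
          and s = "(u - 1) * (2 - u)" and t = "(u - 1) * (3 * u - 1 - u^2) / u"],
        (intro pos_intros pos)+,
        ((simp add: algebra_simps power_numeral_reduce; fail) |
         (simp add: a divide_simps nz; simp add: algebra_simps power_numeral_reduce))+)
  have E3: "?E 3 = vector [(u - 1)^3 / u, (u - 1)^4 / u, (u - 1)^2]"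
    by (rule jpa_expansion_step[OF E2, where d = "0" and e = "a + 2"
          and s = "(u - 1)^2 / u" and t = "(u - 1)^2 * (3 * u - 1 - u^2) / u"],
        (intro pos_intros pos)+,
        ((simp add: algebra_simps power_numeral_reduce; fail) |
         (simp add: a divide_simps nz; simp add: algebra_simps power_numeral_reduce))+)
  have E4: "?E 4 = vector [(u - 1)^4 / u, (u - 1)^5 / u^2, (u - 1)^3 / u]"
    by (rule jpa_expansion_step[OF E3, where d = "0" and e = "a + 3"
          and s = "(u - 1)^3 * (2 - u) / u" and t = "(u - 1)^3 * (3 * u - 1 - u^2) / u^2"],
        (intro pos_intros pos)+,
        ((simp add: algebra_simps power_numeral_reduce; fail) |
         (simp add: a divide_simps nz; simp add: algebra_simps power_numeral_reduce))+)
  show ?thesis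
  proof (rule jpa_periodicI[OF E2 E4 _ unit_of_cubic[OF is_subfield_rat_adjoin]])
    show "(u - 1)^2 / u \<in> rat_adjoin \<tau>"
      by (intro is_subfield_intros[OF is_subfield_rat_adjoin] K)
    show "((u - 1)^2 / u)^3 + of_int (2 * a + 5) * ((u - 1)^2 / u)^2
        + of_int (a^2 + 5 * a + 6) * ((u - 1)^2 / u) - 1 = 0"
      by (simp add: a divide_simps nz; simp add: algebra_simps power_numeral_reduce)
  qed (simp add: divide_simps nz; simp add: algebra_simps power_numeral_reduce)+
qed

section \<open>The expansions for the three roots of the second family\<close>

text \<open>Applied with u = -\<tau>. The vectors at indices 4 and 11 differ by (1-u)^3/u^2, of norm
  1 since 1-u has norm 1 and u has norm -1. The cubic is again the characteristic polynomial of the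
  factor.\<close>

lemma family2_large_negative_root:
  fixes a :: int and u \<tau> :: real
  assumes a: "of_int a = 1 / (u * (1 - u)) - u" and u: "3/4 < u" "u < 1"
    and K: "u \<in> rat_adjoin \<tau>"
  shows "jpa_periodic \<tau> (vector [1, u, u^2])"
proof -
  let ?E = "jpa_expansion (vector [1, u, u^2])"
  \<comment> \<open>The tightest condition is u^2 + 2u - 2 > 0, that is, u > sqrt 3 - 1, about
    0.732. The root for a = 5 is about 0.777, while the one for a = 4, about 0.69, violates
    it.\<close>
  have pos: "0 < u" "0 < 1 - u" "0 < 2 * u - 1" "0 < 2 * u^2 - 1" "0 < 3 * u - 2"
    "0 < 4 * u - 2 - u^2" "0 < u + 1" "0 < u + 2" "0 < u^2 + 2 * u - 2" "0 < u^2 + u - 1"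
    using u power_gt_mult[OF _ u(1)] power2_less_mult[OF _ u(2)] by auto
  have nz: "u \<noteq> 0" "u \<noteq> 1" "1 \<noteq> u"
    using u by auto
  have E0: "?E 0 = vector [1, u, u^2]"
    by (simp add: jpa_expansion_def)
  have E1: "?E 1 = vector [u, u^2, 1]"
    by (rule jpa_expansion_step[OF E0, where d = "0" and e = "0"
          and s = "(1 - u)" and t = "(1 - u) * (u + 1)"],
        (intro pos_intros pos)+,
        ((simp add: algebra_simps power_numeral_reduce; fail) |
         (simp add: a divide_simps nz; simp add: algebra_simps power_numeral_reduce))+)
  have E2: "?E 2 = vector [u^2, (1 - u), u]"
    by (rule jpa_expansion_step[OF E1, where d = "0" and e = "1"
          and s = "u * (1 - u)" and t = "(2 * u - 1)"],
        (intro pos_intros pos)+,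
        ((simp add: algebra_simps power_numeral_reduce; fail) |
         (simp add: a divide_simps nz; simp add: algebra_simps power_numeral_reduce))+)
  have E3: "?E 3 = vector [(1 - u), u * (1 - u), u^2]"
    by (rule jpa_expansion_step[OF E2, where d = "0" and e = "1"
          and s = "(u^2 + u - 1)" and t = "u * (2 * u - 1)"],
        (intro pos_intros pos)+,
        ((simp add: algebra_simps power_numeral_reduce; fail) |
         (simp add: a divide_simps nz; simp add: algebra_simps power_numeral_reduce))+)
  have E4: "?E 4 = vector [u * (1 - u), (1 - u) * (2 * u - 1) / u, (1 - u)]"
    by (rule jpa_expansion_step[OF E3, where d = "0" and e = "a - 3"
          and s = "(1 - u)^2" and t = "(1 - u)^2 / u"],
        (intro pos_intros pos)+,
        ((simp add: algebra_simps power_numeral_reduce; fail) |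
         (simp add: a divide_simps nz; simp add: algebra_simps power_numeral_reduce))+)
  have E5: "?E 5 = vector [(1 - u) * (2 * u - 1) / u, (1 - u)^2, u * (1 - u)]"
    by (rule jpa_expansion_step[OF E4, where d = "0" and e = "1"
          and s = "(1 - u)^3 / u" and t = "(1 - u) * (2 * u - 1)"],
        (intro pos_intros pos)+,
        ((simp add: algebra_simps power_numeral_reduce; fail) |
         (simp add: a divide_simps nz; simp add: algebra_simps power_numeral_reduce))+)
  have E6: "?E 6 = vector [(1 - u)^2, (1 - u)^3 / u, (1 - u) * (2 * u - 1) / u]"
    by (rule jpa_expansion_step[OF E5, where d = "0" and e = "1"
          and s = "(1 - u) * (u^2 + u - 1) / u" and t = "(1 - u) * (4 * u - 2 - u^2) / u"],
        (intro pos_intros pos)+,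
        ((simp add: algebra_simps power_numeral_reduce; fail) |
         (simp add: a divide_simps nz; simp add: algebra_simps power_numeral_reduce))+)
  have E7: "?E 7 = vector [(1 - u)^3 / u, (1 - u)^2 * (u^2 + 2 * u - 2) / u, (1 - u)^2]"
    by (rule jpa_expansion_step[OF E6, where d = "0" and e = "a - 2"
          and s = "(1 - u)^2 * (2 * u - 1) / u" and t = "(1 - u)^3 * (u + 2) / u"],
        (intro pos_intros pos)+,
        ((simp add: algebra_simps power_numeral_reduce; fail) |
         (simp add: a divide_simps nz; simp add: algebra_simps power_numeral_reduce))+)
  \<comment> \<open>The digit a - 5 is where the bound on a shows: it is 0 at a = 5 and would be
    negative for a = 4.\<close>
  have E8: "?E 8 = vector
      [(1 - u)^3 * (2 * u - 1) / u^2,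
       (1 - u)^3 * (u^2 + u - 1) / u^2,
       (1 - u)^3 / u]"
    by (rule jpa_expansion_step[OF E7, where d = "a - 5" and e = "a - 2"
          and s = "(1 - u)^4 / u^2" and t = "(1 - u)^4 * (u + 1) / u^2"],
        (intro pos_intros pos)+,
        ((simp add: algebra_simps power_numeral_reduce; fail) |
         (simp add: a divide_simps nz; simp add: algebra_simps power_numeral_reduce))+)
  have E9: "?E 9 = vector
      [(1 - u)^3 * (u^2 + u - 1) / u^2,
       (1 - u)^4 / u^2,
       (1 - u)^3 * (2 * u - 1) / u^2]"
    by (rule jpa_expansion_step[OF E8, where d = "0" and e = "1"
          and s = "(1 - u)^4 / u" and t = "(1 - u)^3 * (3 * u - 2) / u^2"],
        (intro pos_intros pos)+,
        ((simp add: algebra_simps power_numeral_reduce; fail) |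
         (simp add: a divide_simps nz; simp add: algebra_simps power_numeral_reduce))+)
  have E10: "?E 10 = vector [(1 - u)^4 / u^2, (1 - u)^4 / u, (1 - u)^3 * (u^2 + u - 1) / u^2]"
    by (rule jpa_expansion_step[OF E9, where d = "0" and e = "1"
          and s = "(1 - u)^3 * (u^2 + 2 * u - 2) / u^2" and t = "(1 - u)^3 * (2 * u^2 - 1) / u^2"],
        (intro pos_intros pos)+,
        ((simp add: algebra_simps power_numeral_reduce; fail) |
         (simp add: a divide_simps nz; simp add: algebra_simps power_numeral_reduce))+)
  have E11: "?E 11 = vector [(1 - u)^4 / u, (1 - u)^4 * (2 * u - 1) / u^3, (1 - u)^4 / u^2]"
    by (rule jpa_expansion_step[OF E10, where d = "0" and e = "a - 4"
          and s = "(1 - u)^5 / u^2" and t = "(1 - u)^5 / u^3"],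
        (intro pos_intros pos)+,
        ((simp add: algebra_simps power_numeral_reduce; fail) |
         (simp add: a divide_simps nz; simp add: algebra_simps power_numeral_reduce))+)
  show ?thesis
  proof (rule jpa_periodicI[OF E4 E11 _ unit_of_cubic[OF is_subfield_rat_adjoin]])
    show "(1 - u)^3 / u^2 \<in> rat_adjoin \<tau>"
      by (intro is_subfield_intros[OF is_subfield_rat_adjoin] K)
    show "((1 - u)^3 / u^2)^3 + of_int (4 * a - a^2 - 10) * ((1 - u)^3 / u^2)^2
        + of_int (a^3 - 2 * a^2 - 5 * a + 5) * ((1 - u)^3 / u^2) - 1 = 0"
      by (simp add: a divide_simps nz; simp add: algebra_simps power_numeral_reduce)
  qed (simp add: divide_simps nz; simp add: algebra_simps power_numeral_reduce)+
qed

text \<open>Applied with u = -\<tau>. The vectors at indices 3 and 6 differ by u^2/(1-u), again of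
  norm 1.\<close>

lemma family2_small_negative_root:
  fixes a :: int and u \<tau> :: real
  assumes a: "of_int a = 1 / (u * (1 - u)) - u" and u: "0 < u" "u < 13/50"
    and K: "u \<in> rat_adjoin \<tau>"
  shows "jpa_periodic \<tau> (vector [1, u, u^2])"
proof -
  let ?E = "jpa_expansion (vector [1, u, u^2])"
  \<comment> \<open>Here 1 - 3u - 2u^2 > 0 is decisive; it needs u below about 0.281. The root is
    about 0.256 for a = 5, but about 0.357 for a = 4.\<close>
  have pos: "0 < u" "0 < 1 - u" "0 < 1 - 2 * u - u^2" "0 < 1 - 2 * u" "0 < 1 - 3 * u - 2 * u^2"
    "0 < 1 - 3 * u - u^2" "0 < 1 - u - u^2" "0 < u + 1"
    using u power2_less_mult[OF u] by auto
  have nz: "u \<noteq> 0" "u \<noteq> 1" "1 \<noteq> u"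
    using u by auto
  have E0: "?E 0 = vector [1, u, u^2]"
    by (simp add: jpa_expansion_def)
  have E1: "?E 1 = vector [u, u^2, 1]"
    by (rule jpa_expansion_step[OF E0, where d = "0" and e = "0"
          and s = "(1 - u)" and t = "(1 - u) * (u + 1)"],
        (intro pos_intros pos)+,
        ((simp add: algebra_simps power_numeral_reduce; fail) |
         (simp add: a divide_simps nz; simp add: algebra_simps power_numeral_reduce))+)
  have E2: "?E 2 = vector [u^2, u * (1 - u - u^2) / (1 - u), u]"
    by (rule jpa_expansion_step[OF E1, where d = "0" and e = "a - 2"
          and s = "u * (1 - u)" and t = "u^3 / (1 - u)"],
        (intro pos_intros pos)+,
        ((simp add: algebra_simps power_numeral_reduce; fail) |
         (simp add: a divide_simps nz; simp add: algebra_simps power_numeral_reduce))+)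
  have E3: "?E 3 = vector [u^2 * (1 - 2 * u - u^2) / (1 - u), u^2 * (1 - u - u^2) / (1 - u), u^2]"
    by (rule jpa_expansion_step[OF E2, where d = "a - 2" and e = "a - 2"
          and s = "u^3 * (u + 1) / (1 - u)" and t = "u^4 / (1 - u)"],
        (intro pos_intros pos)+,
        ((simp add: algebra_simps power_numeral_reduce; fail) |
         (simp add: a divide_simps nz; simp add: algebra_simps power_numeral_reduce))+)
  have E4: "?E 4 = vector [u^3 / (1 - u), u^3 * (u + 1) / (1 - u), u^2 * (1 - 2 * u - u^2) / (1 - u)]"
    by (rule jpa_expansion_step[OF E3, where d = "1" and e = "1"
          and s = "u^2 * (1 - 3 * u - u^2) / (1 - u)" and t = "u^2 * (1 - 3 * u - 2 * u^2) / (1 - u)"],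
        (intro pos_intros pos)+,
        ((simp add: algebra_simps power_numeral_reduce; fail) |
         (simp add: a divide_simps nz; simp add: algebra_simps power_numeral_reduce))+)
  have E5: "?E 5 = vector [u^4 / (1 - u), u^3 * (1 - 2 * u) / (1 - u)^2, u^3 / (1 - u)]"
    by (rule jpa_expansion_step[OF E4, where d = "1" and e = "a - 4"
          and s = "u^3" and t = "u^4 / (1 - u)^2"],
        (intro pos_intros pos)+,
        ((simp add: algebra_simps power_numeral_reduce; fail) |
         (simp add: a divide_simps nz; simp add: algebra_simps power_numeral_reduce))+)
  have E6: "?E 6 = vector
      [u^4 * (1 - 2 * u - u^2) / (1 - u)^2,
       u^4 * (1 - u - u^2) / (1 - u)^2,
       u^4 / (1 - u)]"
    by (rule jpa_expansion_step[OF E5, where d = "a - 3" and e = "a - 2"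
          and s = "u^5 * (u + 1) / (1 - u)^2" and t = "u^6 / (1 - u)^2"],
        (intro pos_intros pos)+,
        ((simp add: algebra_simps power_numeral_reduce; fail) |
         (simp add: a divide_simps nz; simp add: algebra_simps power_numeral_reduce))+)
  show ?thesis
  proof (rule jpa_periodicI[OF E3 E6 _ unit_of_cubic[OF is_subfield_rat_adjoin]])
    show "u^2 / (1 - u) \<in> rat_adjoin \<tau>"
      by (intro is_subfield_intros[OF is_subfield_rat_adjoin] K)
    show "(u^2 / (1 - u))^3 + of_int (3 - 2 * a) * (u^2 / (1 - u))^2
        + of_int (a^2 - 3 * a + 2) * (u^2 / (1 - u)) - 1 = 0"
      by (simp add: a divide_simps nz; simp add: algebra_simps power_numeral_reduce)
  qed (simp add: divide_simps nz; simp add: algebra_simps power_numeral_reduce)+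
qed

text \<open>Applied with u = \<tau>. Consecutive vectors, at indices 2 and 3, are already
  proportional, with factor u - a = 1/(u(u+1)). The recurring digits 2a+1 and a^2+a are exactly the
  coefficients of the cubic of this factor, as for any expansion of period one.\<close>

lemma family2_positive_root:
  fixes a :: int and u \<tau> :: real
  assumes a: "of_int a = u - 1 / (u * (u + 1))" and u: "4 < u"
    and K: "u \<in> rat_adjoin \<tau>"
  shows "jpa_periodic \<tau> (vector [1, u, u^2])"
proof -
  let ?E = "jpa_expansion (vector [1, u, u^2])"
  have pos: "0 < u" "0 < u + 1" "0 < 2 * u^3 + 2 * u^2 - 1" "0 < 2 * u^3 + 3 * u^2 + u - 1" "0 < u^2 + u - 1"
    "0 < u^4 - 2 * u^2 - u + 1" "0 < u^4 - u^2 + 1"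
    using u power_gt_mult[OF _ u] by auto
  have nz: "u \<noteq> 0" "u + 1 \<noteq> 0"
    using u by auto
  have E0: "?E 0 = vector [1, u, u^2]"
    by (simp add: jpa_expansion_def)
  have E1: "?E 1 = vector [1 / (u * (u + 1)), (2 * u^3 + 2 * u^2 - 1) / (u^2 * (u + 1)^2), 1]"
    by (rule jpa_expansion_step[OF E0, where d = "a" and e = "a^2"
          and s = "(u^2 + u - 1) / (u * (u + 1))" and t = "(u^4 - u^2 + 1) / (u^2 * (u + 1)^2)"],
        (intro pos_intros pos)+,
        ((simp add: algebra_simps power_numeral_reduce; fail) |
         (simp add: a divide_simps nz; simp add: algebra_simps power_numeral_reduce))+)
  have E2: "?E 2 = vector
      [1 / (u^2 * (u + 1)^2),
       (2 * u^3 + 3 * u^2 + u - 1) / (u^3 * (u + 1)^3),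
       1 / (u * (u + 1))]"
    by (rule jpa_expansion_step[OF E1, where d = "2 * a" and e = "a^2 + a"
          and s = "(u^2 + u - 1) / (u^2 * (u + 1)^2)"
          and t = "(u^4 - 2 * u^2 - u + 1) / (u^3 * (u + 1)^3)"],
        (intro pos_intros pos)+,
        ((simp add: algebra_simps power_numeral_reduce; fail) |
         (simp add: a divide_simps nz; simp add: algebra_simps power_numeral_reduce))+)
  have E3: "?E 3 = vector
      [1 / (u^3 * (u + 1)^3),
       (2 * u^3 + 3 * u^2 + u - 1) / (u^4 * (u + 1)^4),
       1 / (u^2 * (u + 1)^2)]"
    by (rule jpa_expansion_step[OF E2, where d = "2 * a + 1" and e = "a^2 + a"
          and s = "(u^2 + u - 1) / (u^3 * (u + 1)^3)"
          and t = "(u^4 - 2 * u^2 - u + 1) / (u^4 * (u + 1)^4)"],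
        (intro pos_intros pos)+,
        ((simp add: algebra_simps power_numeral_reduce; fail) |
         (simp add: a divide_simps nz; simp add: algebra_simps power_numeral_reduce))+)
  show ?thesis
  proof (rule jpa_periodicI[OF E2 E3 _ unit_of_cubic[OF is_subfield_rat_adjoin]])
    show "1 / (u * (u + 1)) \<in> rat_adjoin \<tau>"
      by (intro is_subfield_intros[OF is_subfield_rat_adjoin] K)
    show "(1 / (u * (u + 1)))^3 + of_int (2 * a + 1) * (1 / (u * (u + 1)))^2
        + of_int (a^2 + a) * (1 / (u * (u + 1))) - 1 = 0"
      by (simp add: a divide_simps nz; simp add: algebra_simps power_numeral_reduce)
  qed (simp add: divide_simps nz; simp add: algebra_simps power_numeral_reduce)+
qed

section \<open>Location of the real roots, and conclusion\<close>

text \<open>Isolating a leaves it multiplied by \<tau>(\<tau>-1), which is positive at every root.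
  The bound a \<ge> 3 then gives a cubic inequality free of a, and this excludes everything outside
  the three intervals.\<close>

lemma family1_root_cases:
  fixes a \<tau> :: real
  assumes "3 \<le> a" and root: "\<tau>^3 + (a - 1) * \<tau>^2 - a * \<tau> - 1 = 0"
  obtains (large_negative) "\<tau> < 0" "14/5 < - \<tau>" "a = - \<tau> + 1 / (- \<tau> * (- \<tau> + 1))"
    | (small_negative) "\<tau> < 0" "- \<tau> < 3/10" "a = - \<tau> + 1 / (- \<tau> * (- \<tau> + 1))"
    | (positive) "1 < \<tau>" "\<tau> < 6/5" "a = 1 / (\<tau> * (\<tau> - 1)) - \<tau>"
proof -
  have eq: "a * (\<tau> * (\<tau> - 1)) = 1 + \<tau>^2 - \<tau>^3"
    using root by (simp add: algebra_simps power_numeral_reduce)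
  \<comment> \<open>At 0 and at 1 the polynomial has the value -1, whatever a is.\<close>
  have "\<tau> \<noteq> 0" "\<tau> \<noteq> 1"
    using root by auto
  then have a: "a = 1 / (\<tau> * (\<tau> - 1)) - \<tau>"
    using eq by (simp add: divide_simps; simp add: algebra_simps power_numeral_reduce)
  show thesis
  proof (cases "\<tau> < 0")
    case True
    define u where "u = - \<tau>"
    then have "0 < u"
      using True by simp
    have "3 * (u * (u + 1)) \<le> a * (u * (u + 1))"
      using \<open>3 \<le> a\<close> \<open>0 < u\<close> by (intro mult_right_mono) auto
    also have "\<dots> = u^3 + u^2 + 1"
      using eq by (simp add: u_def algebra_simps power_numeral_reduce)
    finally have ge: "0 \<le> u^3 - 2 * u^2 - 3 * u + 1"
      by (simp add: algebra_simps power2_eq_square)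
    have "u < 3/10 \<or> 14/5 < u"
    proof (rule ccontr)
      assume "\<not> ?thesis"
      then have "3/10 \<le> u" "u \<le> 14/5"
        by auto
      (* The last factor is chosen so that the cubic below appears up to a linear remainder. *)
      then have "0 \<le> (u - 3/10) * (14/5 - u) * (u + 11/10)"
        by simp
      also have "\<dots> = - (u^3 - 2 * u^2 - 3 * u + 1) - 43/100 * u + 76/1000"
        by (simp add: field_simps power_numeral_reduce)
      finally show False
        using ge \<open>3/10 \<le> u\<close> by linarith
    qed
    moreover have "a = u + 1 / (u * (u + 1))"
      using a by (simp add: u_def algebra_simps)
    ultimately show thesis
      using True large_negative small_negative unfolding u_def by blast
  next
    case False
    then have "0 < \<tau>"
      using \<open>\<tau> \<noteq> 0\<close> by simp
    \<comment> \<open>On (0, 1] the left side of \<open>eq\<close> is at most 0, while the right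
      side is positive.\<close>
    have "1 < \<tau>"
    proof (rule ccontr)
      assume "\<not> 1 < \<tau>"
      then have "\<tau> * (\<tau> - 1) \<le> 0" "\<tau>^3 < 1 + \<tau>^2"
        using \<open>0 < \<tau>\<close> power_decreasing[of 2 3 \<tau>] by (auto simp: mult_nonneg_nonpos)
      then show False
        using eq \<open>3 \<le> a\<close> mult_nonneg_nonpos[of a "\<tau> * (\<tau> - 1)"] by linarith
    qed
    have "3 * (\<tau> * (\<tau> - 1)) \<le> a * (\<tau> * (\<tau> - 1))"
      using \<open>3 \<le> a\<close> \<open>1 < \<tau>\<close> by (intro mult_right_mono) auto
    then have le: "\<tau>^3 + 2 * \<tau>^2 - 3 * \<tau> \<le> 1"
      using eq by (simp add: algebra_simps power2_eq_square)
    have "\<tau> < 6/5"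
    proof (rule ccontr)
      assume "\<not> \<tau> < 6/5"
      \<comment> \<open>These bounds make the left side of \<open>le\<close> at least 0.84 \<tau>,
        hence at least 1.008: a narrow contradiction, as the root for a = 3 is about 1.199.\<close>
      then have "6/5 * \<tau> \<le> \<tau>^2" "6/5 * \<tau>^2 \<le> \<tau>^3" "6/5 \<le> \<tau>"
        by (simp_all add: power_numeral_reduce)
      then show False
        using le by linarith
    qed
    then show thesis
      using positive a \<open>1 < \<tau>\<close> by blast
  qed
qed

lemma family2_root_cases:
  fixes a \<tau> :: real
  assumes "5 \<le> a" and root: "\<tau>^3 - (a - 1) * \<tau>^2 - a * \<tau> - 1 = 0"
  obtains (large_negative) "\<tau> < 0" "3/4 < - \<tau>" "- \<tau> < 1" "a = 1 / (- \<tau> * (1 + \<tau>)) + \<tau>"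
    | (small_negative) "\<tau> < 0" "- \<tau> < 13/50" "a = 1 / (- \<tau> * (1 + \<tau>)) + \<tau>"
    | (positive) "4 < \<tau>" "a = \<tau> - 1 / (\<tau> * (\<tau> + 1))"
proof -
  have eq: "a * (\<tau> * (\<tau> + 1)) = \<tau>^3 + \<tau>^2 - 1"
    using root by (simp add: algebra_simps power_numeral_reduce)
  \<comment> \<open>The polynomial has the value -1 at 0 and at -1.\<close>
  have "\<tau> \<noteq> 0" "\<tau> + 1 \<noteq> 0"
    using root by (auto simp: eq_neg_iff_add_eq_0[symmetric])
  then have a: "a = \<tau> - 1 / (\<tau> * (\<tau> + 1))"
    using eq by (simp add: divide_simps; simp add: algebra_simps power_numeral_reduce)
  show thesis
  proof (cases "\<tau> < 0")
    case True
    define u where "u = - \<tau>"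
    then have "0 < u"
      using True by simp
    have eq': "a * (u * (1 - u)) = u^3 - u^2 + 1"
      using eq by (simp add: u_def algebra_simps power_numeral_reduce)
    have "u < 1"
    proof (rule ccontr)
      assume "\<not> u < 1"
      then have "u * (1 - u) \<le> 0" "u^2 \<le> u^3"
        using \<open>0 < u\<close> by (auto simp: mult_nonneg_nonpos power_increasing)
      then show False
        using eq' \<open>5 \<le> a\<close> mult_nonneg_nonpos[of a "u * (1 - u)"] by linarith
    qed
    have "5 * (u * (1 - u)) \<le> a * (u * (1 - u))"
      using \<open>5 \<le> a\<close> \<open>0 < u\<close> \<open>u < 1\<close> by (intro mult_right_mono) auto
    then have ge: "0 \<le> u^3 + 4 * u^2 - 5 * u + 1"
      using eq' by (simp add: algebra_simps power2_eq_square)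
    have "u < 13/50 \<or> 3/4 < u"
    proof (rule ccontr)
      assume "\<not> ?thesis"
      then have "13/50 \<le> u" "u \<le> 3/4"
        by auto
      \<comment> \<open>The third factor has 501/100 = 4 + 13/50 + 3/4, which matches the quadratic
        coefficient 4 of the cubic in \<open>ge\<close>. The linear remainder is negative from u =
        13/50 on.\<close>
      then have "0 \<le> (u - 13/50) * (3/4 - u) * (u + 501/100)"
        by simp
      also have "\<dots> = - (u^3 + 4 * u^2 - 5 * u + 1) - 1349/10000 * u + 2305/100000"
        by (simp add: field_simps power_numeral_reduce)
      finally show False
        using ge \<open>13/50 \<le> u\<close> by linarith
    qed
    moreover have "a = 1 / (u * (1 - u)) - u"
      using eq' \<open>0 < u\<close> \<open>u < 1\<close>
      by (simp add: divide_simps; simp add: algebra_simps power_numeral_reduce)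
    ultimately show thesis
      using True \<open>u < 1\<close> large_negative small_negative by (auto simp: u_def)
  next
    case False
    then have "0 < \<tau>"
      using \<open>\<tau> \<noteq> 0\<close> by simp
    then have "5 * (\<tau> * (\<tau> + 1)) \<le> a * (\<tau> * (\<tau> + 1))"
      using \<open>5 \<le> a\<close> by (intro mult_right_mono) auto
    then have "4 * \<tau>^2 < \<tau>^3"
      using eq \<open>0 < \<tau>\<close> by (simp add: algebra_simps power2_eq_square)
    then have "4 < \<tau>"
      using \<open>0 < \<tau>\<close> by (simp add: power_numeral_reduce)
    then show thesis
      using positive a by blast
  qed
qed

theorem theorem1p3:
  fixes a :: int and \<tau> :: real
  assumes "(a \<ge> 3 \<and> poly [:-1, - of_int a, of_int (a - 1), 1:] \<tau> = 0) \<or>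
           (a \<ge> 5 \<and> poly [:-1, - of_int a, - of_int (a - 1), 1:] \<tau> = 0)"
  shows "jpa_periodic \<tau> (vector [1, \<bar>\<tau>\<bar>, \<tau>\<^sup>2])"
proof -
  \<comment> \<open>For a negative root the parameter u is -\<tau>, and the recurrence factor has to
    lie in the field of \<tau>.\<close>
  have neg: "- \<tau> \<in> rat_adjoin \<tau>"
    by (intro is_subfield_uminus[OF is_subfield_rat_adjoin] rat_adjoin_self)
  from assms show ?thesis
  proof (elim disjE conjE)
    assume "a \<ge> 3" and "poly [:-1, - of_int a, of_int (a - 1), 1:] \<tau> = 0"
    then have "3 \<le> real_of_int a" "\<tau>^3 + (of_int a - 1) * \<tau>^2 - of_int a * \<tau> - 1 = 0"
      by (simp_all add: algebra_simps power_numeral_reduce)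
    then show ?thesis
    proof (cases rule: family1_root_cases[consumes 2])
      case large_negative
      then show ?thesis
        using family1_large_negative_root[OF _ _ neg] by simp
    next
      case small_negative
      then show ?thesis
        using family1_small_negative_root[OF _ _ _ neg] by simp
    next
      case positive
      then show ?thesis
        using family1_positive_root[OF _ _ _ rat_adjoin_self] by simp
    qed
  next
    assume "a \<ge> 5" and "poly [:-1, - of_int a, - of_int (a - 1), 1:] \<tau> = 0"
    then have "5 \<le> real_of_int a" "\<tau>^3 - (of_int a - 1) * \<tau>^2 - of_int a * \<tau> - 1 = 0"
      by (simp_all add: algebra_simps power_numeral_reduce)
    then show ?thesis
    proof (cases rule: family2_root_cases[consumes 2])
      case large_negative
      then show ?thesis
        using family2_large_negative_root[OF _ _ _ neg] by simp
    next
      case small_negative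
      then show ?thesis
        using family2_small_negative_root[OF _ _ _ neg] by simp
    next
      case positive
      then show ?thesis
        using family2_positive_root[OF _ _ rat_adjoin_self] by simp
    qed
  qed
qed

end
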